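(* Let $L$ be a solvable Leibniz algebra over a field and let $A$ be a minimal ideal of $L$. Then there exists a one-to-one correspondence between the set of distinct conjugacy classes under $I(L,A)$ of complements to $A$ in $L$ and the set of complements to $A$ in $C_L(A)$ that are ideals of $L$.
   Context: Leibniz algebras are finite-dimensional left Leibniz algebras over a field: the product satisfies $x(yz)=(xy)z+y(xz)$, i.e. every left multiplication $L_x: y\mapsto xy$ is a derivation. Ideals are two-sided; a minimal ideal is a nonzero ideal containing no nonzero ideal of $L$ properly. A complement to $A$ in a subalgebra $S\supseteq A$ of $L$ is a subalgebra $M$ of $S$ with $S=A+M$ and $A\cap M=0$. The centralizer is $C_L(A)=\{x\in L: xa=ax=0 \text{ for all } a\in A\}$. For an element $a$ of $L$, $\exp(L_a)=\sum_{r\ge 0}\frac{1}{r!}L_a^r$. $I(L,A)$ is the subgroup of the automorphism group of $L$ generated by all $\exp(L_a)$, $a\in A$; when $A$ is an abelian ideal (as is a minimal ideal of a solvable algebra), $\exp(L_a)=1+L_a$ and $I(L,A)$ consists of all maps $1+L_a$, $a\in A$. Two subalgebras $U,V$ of $L$ are conjugate under $I(L,A)$ if $\beta(U)=V$ for some $\beta\in I(L,A)$. *)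

theory Defs
  imports Complex_Main "HOL-Algebra.Generated_Groups"
begin

(* A left Leibniz algebra over the field 'k: the underlying vector space is the whole type 'v. *)
locale leibniz_algebra = vector_space scale
  for scale :: "'k::field \<Rightarrow> 'v::ab_group_add \<Rightarrow> 'v" +
  fixes mul :: "'v \<Rightarrow> 'v \<Rightarrow> 'v"
  assumes finite_dim: "\<exists>B. finite B \<and> span B = UNIV"
    and linear_left_mul: "Vector_Spaces.linear scale scale (\<lambda>y. mul x y)"
    and linear_right_mul: "Vector_Spaces.linear scale scale (\<lambda>x. mul x y)"
    and leibniz: "mul x (mul y z) = mul (mul x y) z + mul y (mul x z)"
begin

definition leib_subalgebra :: "'v set \<Rightarrow> bool" where
  "leib_subalgebra U \<longleftrightarrow> subspace U \<and> (\<forall>x\<in>U. \<forall>y\<in>U. mul x y \<in> U)"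

definition leib_ideal :: "'v set \<Rightarrow> bool" where
  "leib_ideal J \<longleftrightarrow> subspace J \<and> (\<forall>x. \<forall>y\<in>J. mul x y \<in> J \<and> mul y x \<in> J)"

definition minimal_leib_ideal :: "'v set \<Rightarrow> bool" where
  "minimal_leib_ideal A \<longleftrightarrow>
     leib_ideal A \<and> A \<noteq> {0} \<and> (\<forall>J. leib_ideal J \<and> J \<noteq> {0} \<longrightarrow> \<not> J \<subset> A)"

definition leib_product :: "'v set \<Rightarrow> 'v set \<Rightarrow> 'v set" where
  "leib_product U V = span {mul u v | u v. u \<in> U \<and> v \<in> V}"

primrec leib_derived :: "nat \<Rightarrow> 'v set" where
  "leib_derived 0 = UNIV"
| "leib_derived (Suc n) = leib_product (leib_derived n) (leib_derived n)"

definition solvable_leib :: bool where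
  "solvable_leib \<longleftrightarrow> (\<exists>n. leib_derived n = {0})"

definition leib_complements :: "'v set \<Rightarrow> 'v set \<Rightarrow> 'v set set" where
  "leib_complements A S =
     {M. leib_subalgebra M \<and> M \<subseteq> S \<and> S = {a + m | a m. a \<in> A \<and> m \<in> M} \<and> A \<inter> M = {0}}"

definition leib_centralizer :: "'v set \<Rightarrow> 'v set" where
  "leib_centralizer A = {x. \<forall>a\<in>A. mul x a = 0 \<and> mul a x = 0}"

definition leib_automorphism :: "('v \<Rightarrow> 'v) \<Rightarrow> bool" where
  "leib_automorphism f \<longleftrightarrow>
     Vector_Spaces.linear scale scale f \<and> bij f \<and> (\<forall>x y. f (mul x y) = mul (f x) (f y))"

definition leib_aut_group :: "('v \<Rightarrow> 'v) monoid" where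
  "leib_aut_group = \<lparr>carrier = {f. leib_automorphism f}, mult = (\<circ>), one = id\<rparr>"

lemma group_leib_aut_group: "group leib_aut_group"
proof (rule groupI)
  fix f assume "f \<in> carrier leib_aut_group"
  then have f: "Vector_Spaces.linear scale scale f" "bij f"
      "\<And>x y. f (mul x y) = mul (f x) (f y)"
    by (auto simp: leib_aut_group_def leib_automorphism_def)
  interpret f: Vector_Spaces.linear scale scale f by (rule f(1))
  let ?g = "inv_into UNIV f"
  have fg: "f (?g x) = x" for x using f(2) by (simp add: bij_is_surj surj_f_inv_f)
  have gf: "?g (f x) = x" for x using f(2) by (simp add: bij_is_inj)
  have gI: "?g y = x" if "f x = y" for x y using that gf by auto
  have "Vector_Spaces.linear scale scale ?g"
    by unfold_locales (auto intro!: gI simp: f.add f.scale fg)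
  moreover have "?g (mul x y) = mul (?g x) (?g y)" for x y
    by (rule gI) (simp add: f(3) fg)
  ultimately have "leib_automorphism ?g"
    using f(2) by (auto simp: leib_automorphism_def bij_imp_bij_inv)
  moreover have "?g \<circ> f = id" using gf by auto
  ultimately show "\<exists>g\<in>carrier leib_aut_group. g \<otimes>\<^bsub>leib_aut_group\<^esub> f = \<one>\<^bsub>leib_aut_group\<^esub>"
    by (auto simp: leib_aut_group_def)
qed (auto simp: leib_aut_group_def leib_automorphism_def comp_assoc linear_id bij_comp
       intro: Vector_Spaces.linear_compose)

(* The exponential series of left multiplication by a, with only the nonvanishing terms
   summed. It is meaningful when left multiplication by a is nilpotent and the factorials
   occurring are invertible in the field; for a in an abelian ideal, only the terms
   r = 0 and r = 1 can be nonzero, so this holds in every characteristic. *)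
definition exp_left_mul :: "'v \<Rightarrow> 'v \<Rightarrow> 'v" where
  "exp_left_mul a x =
     (\<Sum>r | (mul a ^^ r) x \<noteq> 0. scale (inverse (of_nat (fact r))) ((mul a ^^ r) x))"

lemma exp_left_mul_eq:
  assumes "leib_ideal A" and "\<And>a b. a \<in> A \<Longrightarrow> b \<in> A \<Longrightarrow> mul a b = 0" and "a \<in> A"
  shows "exp_left_mul a x = x + mul a x"
proof -
  have m0: "mul a 0 = 0"
    using linear_left_mul[of a] by (rule module_hom.zero[OF Vector_Spaces.linear.axioms(3)])
  have m2: "mul a (mul a x) = 0"
    using assms by (auto simp: leib_ideal_def)
  have big: "(mul a ^^ (Suc (Suc n))) x = 0" for n
    by (induction n) (auto simp: m0 m2)
  have sub: "{r. (mul a ^^ r) x \<noteq> 0} \<subseteq> {0, Suc 0}"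
  proof
    fix r assume r: "r \<in> {r. (mul a ^^ r) x \<noteq> 0}"
    show "r \<in> {0, Suc 0}"
    proof (rule ccontr)
      assume "r \<notin> {0, Suc 0}"
      then have "r = Suc (Suc (r - 2))" by auto
      with big[of "r - 2"] r show False by (metis mem_Collect_eq)
    qed
  qed
  have "exp_left_mul a x =
      (\<Sum>r\<in>{0, Suc 0}. scale (inverse (of_nat (fact r))) ((mul a ^^ r) x))"
    unfolding exp_left_mul_def by (rule sum.mono_neutral_left) (use sub in auto)
  then show ?thesis by simp
qed

(* I(L, A), as a set of maps *)
definition leib_inner_group :: "'v set \<Rightarrow> ('v \<Rightarrow> 'v) set" where
  "leib_inner_group A = generate leib_aut_group (exp_left_mul ` A)"

definition conjugate_under :: "('v \<Rightarrow> 'v) set \<Rightarrow> 'v set \<Rightarrow> 'v set \<Rightarrow> bool" where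
  "conjugate_under G U V \<longleftrightarrow> (\<exists>\<beta>\<in>G. \<beta> ` U = V)"

definition complement_classes :: "'v set \<Rightarrow> 'v set set set" where
  "complement_classes A =
     leib_complements A UNIV //
       {(U, V). U \<in> leib_complements A UNIV \<and> V \<in> leib_complements A UNIV \<and>
                conjugate_under (leib_inner_group A) U V}"

end

end

theory Submission
  imports Defs
begin

text \<open>
  Write \<open>C\<close> for the centralizer of \<open>A\<close>. The correspondence sends a complement \<open>M\<close> to \<open>M \<inter> C\<close>.
  Since \<open>A\<close> is minimal, either \<open>a x = 0\<close> for all \<open>a \<in> A\<close> and all \<open>x\<close>, or always \<open>a x = - x a\<close>.
  If \<open>C\<close> is not the whole algebra, take the last term \<open>B\<close> of the derived series not contained in
  \<open>C\<close>. For \<open>b \<in> B\<close> the elements of \<open>A\<close> killed by a power of \<open>L\<^sub>b\<close> form an ideal, and commuting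
  nilpotent operators have a common null vector, so some \<open>b \<in> B\<close> acts invertibly on \<open>A\<close>; moreover
  \<open>L\<^sub>b\<^sup>2\<close> maps everything into \<open>C\<close>. For an ideal \<open>D\<close> complementing \<open>A\<close> in \<open>C\<close> the set
  \<open>M\<^sub>b = {x. b (b x) \<in> D}\<close>, a Fitting null component modulo \<open>D\<close>, is then a complement of \<open>A\<close> with
  \<open>M\<^sub>b \<inter> C = D\<close>. Every complement \<open>U\<close> with \<open>U \<inter> C = D\<close> equals \<open>M\<^sub>u\<close> for any \<open>u \<in> U \<inter> (b + A)\<close>. If
  \<open>A\<close> acts as zero on the left, \<open>M\<^sub>u\<close> does not depend on the choice of \<open>u \<in> b + A\<close>; otherwise
  \<open>(1 + L\<^sub>a) u = u - u a\<close> runs through all of \<open>b + A\<close>, which gives the conjugacy.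
\<close>

text \<open>Each kernel class has a one-element image, from which \<open>the_elem\<close> reads off
  the common value of \<open>f\<close>.\<close>

lemma bij_betw_quotient_kernel:
  assumes "f ` X = Y"
  shows "bij_betw (\<lambda>K. the_elem (f ` K)) (X // {(u, v). u \<in> X \<and> v \<in> X \<and> f u = f v}) Y"
proof -
  let ?r = "{(u, v). u \<in> X \<and> v \<in> X \<and> f u = f v}"
  have cls: "the_elem (f ` (?r `` {u})) = f u" if "u \<in> X" for u
  proof -
    have "f ` (?r `` {u}) = {f u}" using that by auto
    then show ?thesis by simp
  qed
  show ?thesis
  proof (rule bij_betwI')
    fix K K' assume "K \<in> X // ?r" "K' \<in> X // ?r"
    then obtain u v where "u \<in> X" "K = ?r `` {u}" "v \<in> X" "K' = ?r `` {v}"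
      by (auto elim!: quotientE)
    then show "(the_elem (f ` K) = the_elem (f ` K')) = (K = K')"
      using cls by auto
  next
    fix K assume "K \<in> X // ?r"
    then show "the_elem (f ` K) \<in> Y"
      using cls assms by (auto elim!: quotientE)
  next
    fix y assume "y \<in> Y"
    then obtain u where "u \<in> X" "f u = y" using assms by auto
    then show "\<exists>K\<in>X // ?r. y = the_elem (f ` K)"
      using cls[of u] by (intro bexI[of _ "?r `` {u}"] quotientI) (simp_all only:)
  qed
qed

section \<open>Arithmetic, ideals and finite dimension in a Leibniz algebra\<close>

context leibniz_algebra
begin

lemma mul_add_right: "mul x (y + z) = mul x y + mul x z"
  using linear_left_mul[of x] by (rule module_hom.add[OF Vector_Spaces.linear.axioms(3)])

lemma mul_add_left: "mul (x + y) z = mul x z + mul y z"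
  using linear_right_mul[of z] by (rule module_hom.add[OF Vector_Spaces.linear.axioms(3)])

lemma mul_scale_right: "mul x (scale c y) = scale c (mul x y)"
  using linear_left_mul[of x] by (rule module_hom.scale[OF Vector_Spaces.linear.axioms(3)])

lemma mul_scale_left: "mul (scale c x) y = scale c (mul x y)"
  using linear_right_mul[of y] by (rule module_hom.scale[OF Vector_Spaces.linear.axioms(3)])

lemma mul_zero_right [simp]: "mul x 0 = 0"
  using mul_add_right[of x 0 0] by simp

lemma mul_zero_left [simp]: "mul 0 x = 0"
  using mul_add_left[of 0 0 x] by simp

lemma mul_minus_right: "mul x (- y) = - mul x y"
  using mul_add_right[of x y "- y"] by (simp add: eq_neg_iff_add_eq_0 add.commute)

lemma mul_diff_right: "mul x (y - z) = mul x y - mul x z"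
  using mul_add_right[of x y "- z"] by (simp add: mul_minus_right)

lemma mul_mul_left: "mul (mul x y) z = mul x (mul y z) - mul y (mul x z)"
  by (simp add: leibniz[of x y z])

text \<open>The expansions by \<open>mul_mul_left\<close> cancel: symmetrised products, which would
  vanish in a Lie algebra, at least lie in the left annihilator.\<close>

lemma mul_sym_left_zero: "mul (mul x y + mul y x) z = 0"
  by (simp add: mul_add_left mul_mul_left)

text \<open>Second-order Leibniz rule for the derivation given by \<open>b\<close>. The middle term
  is a sum of two copies, so that closure of ideals under addition covers it.\<close>

lemma left_mul_twice_mul:
  "mul b (mul b (mul x y)) =
     mul (mul b (mul b x)) y + (mul (mul b x) (mul b y) + mul (mul b x) (mul b y))
       + mul x (mul b (mul b y))"
  by (simp only: leibniz[of b x y] mul_add_right leibniz[of b "mul b x" y]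
      leibniz[of b x "mul b y"] add.assoc)

lemma ideal_subspace: "leib_ideal J \<Longrightarrow> subspace J"
  and ideal_mul_right: "leib_ideal J \<Longrightarrow> y \<in> J \<Longrightarrow> mul x y \<in> J"
  and ideal_mul_left: "leib_ideal J \<Longrightarrow> y \<in> J \<Longrightarrow> mul y x \<in> J"
  by (auto simp: leib_ideal_def)

lemma ideal_zero: "leib_ideal J \<Longrightarrow> 0 \<in> J"
  and ideal_add: "leib_ideal J \<Longrightarrow> x \<in> J \<Longrightarrow> y \<in> J \<Longrightarrow> x + y \<in> J"
  and ideal_diff: "leib_ideal J \<Longrightarrow> x \<in> J \<Longrightarrow> y \<in> J \<Longrightarrow> x - y \<in> J"
  and ideal_uminus: "leib_ideal J \<Longrightarrow> x \<in> J \<Longrightarrow> - x \<in> J"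
  by (simp_all add: leib_ideal_def subspace_0 subspace_add subspace_diff subspace_neg)

lemma leib_productI: "u \<in> U \<Longrightarrow> v \<in> V \<Longrightarrow> mul u v \<in> leib_product U V"
  unfolding leib_product_def by (rule span_base) auto

lemma leib_product_mono: "U \<subseteq> U' \<Longrightarrow> V \<subseteq> V' \<Longrightarrow> leib_product U V \<subseteq> leib_product U' V'"
  unfolding leib_product_def by (rule span_mono) blast

lemma ideal_spanI:
  assumes "\<And>x s. s \<in> S \<Longrightarrow> mul x s \<in> span S" and "\<And>x s. s \<in> S \<Longrightarrow> mul s x \<in> span S"
  shows "leib_ideal (span S)"
proof -
  have "mul x y \<in> span S \<and> mul y x \<in> span S" if "y \<in> span S" for x y
    using that
  proof (induction rule: span_induct_alt)
    case (step c s y)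
    then show ?case
      using assms[OF step(1)]
      by (simp add: mul_add_left mul_add_right mul_scale_left mul_scale_right span_add span_scale)
  qed (auto simp: span_zero)
  then show ?thesis by (simp add: leib_ideal_def)
qed

lemma ideal_leib_product:
  assumes "leib_ideal J"
  shows "leib_ideal (leib_product J J)"
proof -
  have base: "mul x s \<in> leib_product J J \<and> mul s x \<in> leib_product J J"
    if s: "s \<in> {mul u v | u v. u \<in> J \<and> v \<in> J}" for x s
  proof -
    obtain u v where uv: "s = mul u v" "u \<in> J" "v \<in> J" using s by auto
    have "mul (mul x u) v \<in> leib_product J J" "mul u (mul x v) \<in> leib_product J J"
         "mul u (mul v x) \<in> leib_product J J" "mul v (mul u x) \<in> leib_product J J"
      using uv assms by (auto intro!: leib_productI intro: ideal_mul_left ideal_mul_right)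
    then show ?thesis
      unfolding uv(1) leibniz[of x u v] mul_mul_left[of u v x]
      by (simp add: leib_product_def span_add span_diff)
  qed
  then show ?thesis
    unfolding leib_product_def by (intro ideal_spanI) auto
qed

lemma ideal_leib_derived: "leib_ideal (leib_derived n)"
proof (induction n)
  case 0
  show ?case by (auto simp: leib_ideal_def)
qed (simp add: ideal_leib_product)

lemma subspace_left_mul_vimage: "subspace D \<Longrightarrow> subspace {x. mul b (mul b x) \<in> D}"
  by (auto simp: subspace_def mul_add_right mul_scale_right)

lemma subspace_finite_span:
  assumes "subspace V"
  obtains S where "finite S" "S \<subseteq> V" "span S = V"
proof -
  obtain T where T: "finite T" "span T = UNIV" using finite_dim by auto
  obtain S where S: "S \<subseteq> V" "independent S" "V \<subseteq> span S"
    by (rule maximal_independent_subset)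
  have "finite S" using independent_span_bound[OF T(1) S(2)] T(2) by simp
  moreover have "span S = V" using S assms span_minimal by blast
  ultimately show ?thesis using S(1) that by blast
qed

lemma left_mul_inj_imp_surj:
  assumes "subspace V" and "\<And>v. v \<in> V \<Longrightarrow> mul b v \<in> V"
    and "\<And>v. v \<in> V \<Longrightarrow> mul b v = 0 \<Longrightarrow> v = 0" and "w \<in> V"
  obtains v where "v \<in> V" "mul b v = w"
proof -
  obtain T where T: "finite T" "span T = UNIV" using finite_dim by auto
  obtain S where S: "S \<subseteq> UNIV" "independent S" "UNIV \<subseteq> span S"
    by (rule maximal_independent_subset)
  have "finite S" using independent_span_bound[OF T(1) S(2)] T(2) by simp
  \<comment> \<open>Dimension theory needs a fixed finite basis, while the locale only supplies a
    finite spanning set; \<open>T\<close> bounds the independent set \<open>S\<close>.\<close>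
  then interpret fd: finite_dimensional_vector_space scale S
    using S by unfold_locales auto
  interpret pair: finite_dimensional_vector_space_pair scale S scale S ..
  have inj: "inj_on (mul b) V"
    unfolding pair.linear_inj_on_iff_eq_0[OF linear_left_mul assms(1)]
    using assms(3) by blast
  have "dim (mul b ` V) = dim V"
    using inj assms(1) pair.dim_image_eq[OF linear_left_mul]
    by (simp add: span_eq_iff[THEN iffD2])
  moreover have "subspace (mul b ` V)"
    using linear_left_mul assms(1) pair.linear_subspace_image by blast
  ultimately have "mul b ` V = V"
    using assms(1,2) by (intro fd.subspace_dim_equal) auto
  then show ?thesis using that assms(4) by (metis imageE)
qed

text \<open>Modular law: in \<open>v = a + u\<close> both \<open>v\<close> and \<open>u\<close> lie
  in \<open>V\<close>, so \<open>a\<close> lies in \<open>A\<close> and \<open>V\<close> and is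
  zero.\<close>

lemma complements_subset_eq:
  assumes "U \<in> leib_complements A S" "V \<in> leib_complements A S" "U \<subseteq> V"
  shows "U = V"
proof
  show "V \<subseteq> U"
  proof
    fix v assume v: "v \<in> V"
    with assms obtain a u where au: "v = a + u" "a \<in> A" "u \<in> U"
      unfolding leib_complements_def by blast
    then have "a = v - u" by simp
    moreover have "subspace V" and "A \<inter> V = {0}"
      using assms(2) by (simp_all add: leib_complements_def leib_subalgebra_def)
    ultimately have "a = 0" using v au assms(3) subspace_diff by blast
    then show "v \<in> U" using au by simp
  qed
qed (rule assms)

end

section \<open>A minimal ideal of a solvable algebra and the action on it\<close>

locale solvable_leibniz_minimal_ideal = leibniz_algebra scale mul
  for scale :: "'k::field \<Rightarrow> 'v::ab_group_add \<Rightarrow> 'v" and mul :: "'v \<Rightarrow> 'v \<Rightarrow> 'v" +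
  fixes A :: "'v set"
  assumes solvable: solvable_leib
    and minimal: "minimal_leib_ideal A"
begin

abbreviation C :: "'v set" where "C \<equiv> leib_centralizer A"

lemma ideal_A: "leib_ideal A"
  using minimal by (simp add: minimal_leib_ideal_def)

lemma minimal_cases: "leib_ideal J \<Longrightarrow> J \<subseteq> A \<Longrightarrow> J = {0} \<or> J = A"
  using minimal unfolding minimal_leib_ideal_def by blast

text \<open>By minimality the ideal \<open>leib_product A A\<close> is \<open>{0}\<close> or
  \<open>A\<close>; in the second case \<open>A\<close> lies in every term of the derived series and
  so is zero.\<close>

lemma mul_A_A:
  assumes "a \<in> A" "b \<in> A"
  shows "mul a b = 0"
proof -
  have "leib_product A A \<subseteq> A"
    unfolding leib_product_def
    by (rule span_minimal) (auto intro: ideal_mul_left ideal_A ideal_subspace)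
  then consider "leib_product A A = {0}" | "leib_product A A = A"
    using minimal_cases ideal_leib_product ideal_A by blast
  then show ?thesis
  proof cases
    case 1
    then show ?thesis using leib_productI[OF assms] by simp
  next
    case 2
    have "A \<subseteq> leib_derived n" for n
    proof (induction n)
      case (Suc n)
      then show ?case using leib_product_mono[OF Suc Suc] 2 by simp
    qed simp
    then have "A \<subseteq> {0}" using solvable unfolding solvable_leib_def by metis
    then show ?thesis using assms by auto
  qed
qed

text \<open>The elements \<open>mul x a + mul a x\<close> span an ideal inside \<open>A\<close>. If
  it is zero, the second alternative holds; if it is \<open>A\<close>, the first follows from
  \<open>mul_sym_left_zero\<close>.\<close>

lemma right_action_cases:
  "(\<forall>a\<in>A. \<forall>x. mul a x = 0) \<or> (\<forall>a\<in>A. \<forall>x. mul a x = - mul x a)"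
proof -
  let ?S = "{mul x a + mul a x | x a. a \<in> A}"
  have "leib_ideal (span ?S)"
  proof (rule ideal_spanI)
    fix y s assume "s \<in> ?S"
    then obtain x a where s: "s = mul x a + mul a x" "a \<in> A" by auto
    \<comment> \<open>The terms regroup into the symmetrised products of \<open>mul y x\<close> with
      \<open>a\<close> and of \<open>x\<close> with \<open>mul y a\<close>.\<close>
    have "mul y s = (mul (mul y x) a + mul a (mul y x)) + (mul x (mul y a) + mul (mul y a) x)"
      by (simp add: s mul_add_right leibniz[of y x a] leibniz[of y a x] algebra_simps)
    moreover have "mul (mul y x) a + mul a (mul y x) \<in> ?S" "mul x (mul y a) + mul (mul y a) x \<in> ?S"
      using s(2) ideal_mul_right[OF ideal_A] by blast+
    ultimately show "mul y s \<in> span ?S" by (simp add: span_add span_base)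
    show "mul s y \<in> span ?S" by (simp add: s mul_sym_left_zero span_zero)
  qed
  moreover have "span ?S \<subseteq> A"
    by (rule span_minimal)
      (auto intro: ideal_add ideal_mul_left ideal_mul_right ideal_A ideal_subspace)
  ultimately consider "span ?S = {0}" | "span ?S = A"
    using minimal_cases by blast
  then show ?thesis
  proof cases
    case 1
    have "mul a x = - mul x a" if "a \<in> A" for a x
    proof -
      have "mul x a + mul a x \<in> span ?S" using that by (intro span_base) blast
      then show ?thesis using 1 by (simp add: eq_neg_iff_add_eq_0 add.commute)
    qed
    then show ?thesis by blast
  next
    case 2
    have "mul a x = 0" if "a \<in> span ?S" for a x
      using that
    proof (induction rule: span_induct_alt)
      case (step c s y)
      then have "mul s x = 0" using mul_sym_left_zero by auto
      then show ?case using step by (simp add: mul_add_left mul_scale_left)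
    qed simp
    then show ?thesis using 2 by blast
  qed
qed

lemma right_mul_A_eq_0: "a \<in> A \<Longrightarrow> mul x a = 0 \<Longrightarrow> mul a x = 0"
  using right_action_cases by (metis neg_0_equal_iff_equal)

text \<open>Under either alternative for the right action, vanishing on the left forces vanishing on
  the right. Hence \<open>C\<close> is the kernel of the action on \<open>A\<close> by left
  multiplications.\<close>

lemma C_iff: "x \<in> C \<longleftrightarrow> (\<forall>a\<in>A. mul x a = 0)"
  using right_mul_A_eq_0 by (auto simp: leib_centralizer_def)

lemma ideal_subset_AI:
  assumes "subspace J" "J \<subseteq> A" "\<And>x a. a \<in> J \<Longrightarrow> mul x a \<in> J"
  shows "leib_ideal J"
proof -
  have "mul a x \<in> J" if "a \<in> J" for a x
    using right_action_cases
  proof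
    assume "\<forall>a\<in>A. \<forall>x. mul a x = 0"
    then show ?thesis using that assms by (auto simp: subspace_0)
  next
    assume "\<forall>a\<in>A. \<forall>x. mul a x = - mul x a"
    then show ?thesis using that assms by (auto simp: subspace_neg)
  qed
  then show ?thesis using assms by (auto simp: leib_ideal_def)
qed

lemma ideal_C: "leib_ideal C"
proof -
  have "subspace C"
    by (auto simp: subspace_def leib_centralizer_def mul_add_left mul_add_right
        mul_scale_left mul_scale_right)
  moreover have "mul x y \<in> C \<and> mul y x \<in> C" if "y \<in> C" for x y
    using that ideal_mul_right[OF ideal_A] by (auto simp: C_iff mul_mul_left)
  ultimately show ?thesis by (simp add: leib_ideal_def)
qed

lemma A_subset_C: "A \<subseteq> C"
  by (auto simp: leib_centralizer_def mul_A_A)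

section \<open>Elements acting invertibly on the minimal ideal\<close>

text \<open>By finite dimension, injectivity on \<open>A\<close> means invertibility. The other
  condition lets \<open>mul b (mul b x)\<close> be split along a complement of \<open>A\<close> in
  \<open>C\<close>.\<close>

definition regular :: "'v \<Rightarrow> bool" where
  "regular b \<longleftrightarrow> (\<forall>x. mul b (mul b x) \<in> C) \<and> (\<forall>a\<in>A. mul b a = 0 \<longrightarrow> a = 0)"

text \<open>The extra terms fall into \<open>C\<close> because \<open>A\<close> does, and
  \<open>A\<close>, being abelian, does not change the action on itself. So regularity depends only
  on the coset modulo \<open>A\<close>.\<close>

lemma regular_add_A:
  assumes "regular b" "a \<in> A"
  shows "regular (b + a)"
proof -
  have "mul (b + a) (mul (b + a) x) \<in> C" for x
  proof -
    have "mul (b + a) (mul (b + a) x) =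
        mul b (mul b x) + (mul b (mul a x) + mul a (mul b x) + mul a (mul a x))"
      by (simp add: mul_add_left mul_add_right algebra_simps)
    moreover have "mul b (mul a x) + mul a (mul b x) + mul a (mul a x) \<in> C"
      using assms A_subset_C
      by (intro ideal_add[OF ideal_C])
        (auto intro: ideal_mul_left ideal_mul_right ideal_C)
    ultimately show ?thesis
      using assms by (simp add: regular_def ideal_add[OF ideal_C])
  qed
  moreover have "mul (b + a) c = mul b c" if "c \<in> A" for c
    using that assms by (simp add: mul_add_left mul_A_A)
  ultimately show ?thesis using assms by (simp add: regular_def)
qed

lemma regular_surj:
  assumes "regular b" "a \<in> A"
  obtains c where "c \<in> A" "mul b c = a"
proof (rule left_mul_inj_imp_surj[of A b a])
  fix c assume "c \<in> A" "mul b c = a"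
  then show thesis by (rule that)
qed (use assms in \<open>auto simp: regular_def intro: ideal_mul_right ideal_A ideal_subspace\<close>)

lemma left_mul_power_zero_mono: "(mul b ^^ k) a = 0 \<Longrightarrow> k \<le> l \<Longrightarrow> (mul b ^^ l) a = 0"
proof (induction l)
  case (Suc l)
  then show ?case by (cases "k = Suc l") auto
qed simp

text \<open>This is the Fitting null component of \<open>b\<close> on \<open>A\<close>. Moving
  \<open>b\<close> past \<open>x\<close> produces \<open>mul b x\<close>, whose action on
  \<open>A\<close> commutes with that of \<open>b\<close> since \<open>mul b (mul b x)\<close>
  centralizes \<open>A\<close>.\<close>

lemma ideal_left_mul_null:
  assumes b: "\<And>x. mul b (mul b x) \<in> C"
  shows "leib_ideal {a \<in> A. \<exists>k. (mul b ^^ k) a = 0}" (is "leib_ideal ?J")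
proof (rule ideal_subset_AI)
  have add: "(mul b ^^ k) (x + y) = (mul b ^^ k) x + (mul b ^^ k) y" for k x y
    by (induction k) (auto simp: mul_add_right)
  have scl: "(mul b ^^ k) (scale c x) = scale c ((mul b ^^ k) x)" for k c x
    by (induction k) (auto simp: mul_scale_right)
  have zero: "(mul b ^^ k) 0 = 0" for k
    by (induction k) auto
  have pA: "(mul b ^^ k) a \<in> A" if "a \<in> A" for k a
    using that by (induction k) (auto intro: ideal_mul_right ideal_A)
  show "subspace ?J"
    unfolding subspace_def
  proof (intro conjI ballI allI)
    show "0 \<in> ?J" using ideal_zero[OF ideal_A] zero by auto
  next
    fix x y assume "x \<in> ?J" "y \<in> ?J"
    then obtain k l where "x \<in> A" "y \<in> A" "(mul b ^^ k) x = 0" "(mul b ^^ l) y = 0" by auto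
    then show "x + y \<in> ?J"
      using left_mul_power_zero_mono[of k b x "max k l"] left_mul_power_zero_mono[of l b y "max k l"]
      by (auto simp: add ideal_add[OF ideal_A] intro!: exI[of _ "max k l"])
  next
    fix c x assume "x \<in> ?J"
    then show "scale c x \<in> ?J"
      using subspace_scale[OF ideal_subspace[OF ideal_A]] by (auto simp: scl)
  qed
  fix x a assume "a \<in> ?J"
  then obtain k where k: "a \<in> A" "(mul b ^^ k) a = 0" by auto
  have comm: "(mul b ^^ j) (mul (mul b x) c) = mul (mul b x) ((mul b ^^ j) c)" if "c \<in> A" for j c
  proof (induction j)
    case (Suc j)
    have "mul (mul b (mul b x)) ((mul b ^^ j) c) = 0"
      using b pA[OF that] C_iff by blast
    then show ?case using Suc by (simp add: leibniz[of b "mul b x" "(mul b ^^ j) c"])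
  qed simp
  have "\<exists>j. (mul b ^^ j) (mul x c) = 0" if "c \<in> A" "(mul b ^^ l) c = 0" for l c
    using that
  proof (induction l arbitrary: c)
    case (Suc l)
    then have "mul b c \<in> A" "(mul b ^^ l) (mul b c) = 0"
      by (auto intro: ideal_mul_right ideal_A simp: funpow_swap1)
    then obtain j where j: "(mul b ^^ j) (mul x (mul b c)) = 0" using Suc.IH by blast
    \<comment> \<open>One exponent for both summands: \<open>Suc l\<close> kills the first via
      \<open>comm\<close>, and \<open>j\<close> kills the second. One further power is spent on the
      derivation rule.\<close>
    let ?m = "max j (Suc l)"
    have "(mul b ^^ Suc ?m) (mul x c) = (mul b ^^ ?m) (mul (mul b x) c + mul x (mul b c))"
      by (simp only: funpow_Suc_right o_apply leibniz[of b x c])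
    also have "\<dots> = 0"
      using comm[OF Suc.prems(1), of ?m] left_mul_power_zero_mono[OF Suc.prems(2), of ?m]
        left_mul_power_zero_mono[OF j, of ?m]
      by (simp add: add)
    finally show ?case by blast
  qed (auto intro: exI[of _ 0])
  then show "mul x a \<in> ?J" using k by (auto intro: ideal_mul_right ideal_A)
qed auto

lemma exists_regular:
  assumes "C \<noteq> UNIV"
  obtains b where "regular b"
proof -
  obtain N where "leib_derived N = {0}" using solvable by (auto simp: solvable_leib_def)
  then have "leib_derived N \<subseteq> C" using ideal_zero[OF ideal_C] by simp
  moreover have "\<not> leib_derived 0 \<subseteq> C" using assms by auto
  ultimately obtain n where n: "\<not> leib_derived n \<subseteq> C" "leib_derived (Suc n) \<subseteq> C"
    using ex_least_nat_less[of "\<lambda>n. leib_derived n \<subseteq> C" N] by blast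
  define B where "B = leib_derived n"
  have B: "leib_ideal B" unfolding B_def by (rule ideal_leib_derived)
  have BB: "mul b b' \<in> C" if "b \<in> B" "b' \<in> B" for b b'
    using leib_productI[OF that] n(2) by (auto simp: B_def)
  have bbC: "mul b (mul b x) \<in> C" if "b \<in> B" for b x
    using that B BB ideal_mul_left by blast
  have "\<exists>b\<in>B. \<forall>a\<in>A. mul b a = 0 \<longrightarrow> a = 0"
  proof (rule ccontr)
    assume neg: "\<not> ?thesis"
    \<comment> \<open>A null vector makes the null component nonzero, hence all of \<open>A\<close>
      by minimality.\<close>
    have nil: "\<exists>k. (mul b ^^ k) a = 0" if b: "b \<in> B" and a: "a \<in> A" for a b
    proof -
      let ?J = "{a \<in> A. \<exists>k. (mul b ^^ k) a = 0}"
      obtain c where c: "c \<in> A" "mul b c = 0" "c \<noteq> 0" using neg b by blast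
      have "(mul b ^^ 1) c = 0" using c by simp
      then have "c \<in> ?J" using c by blast
      then have "?J \<noteq> {0}" using c(3) by blast
      then have "?J = A" using minimal_cases[OF ideal_left_mul_null[OF bbC[OF b]]] by blast
      then show ?thesis using a by blast
    qed
    obtain S where S: "finite S" "S \<subseteq> B" "span S = B"
      using subspace_finite_span[OF ideal_subspace[OF B]] by blast
    \<comment> \<open>Engel-type argument: a common null vector is built one generator at a
      time.\<close>
    have "\<exists>a\<in>A. a \<noteq> 0 \<and> (\<forall>s\<in>S. mul s a = 0)"
      using S(1,2)
    proof (induction rule: finite_induct)
      case empty
      then show ?case using minimal ideal_zero[OF ideal_A]
        by (auto simp: minimal_leib_ideal_def)
    next
      case (insert b F)
      then obtain a where a: "a \<in> A" "a \<noteq> 0" "\<forall>s\<in>F. mul s a = 0" by auto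
      have b: "b \<in> B" using insert by auto
      \<comment> \<open>The last nonzero iterate of \<open>b\<close> on \<open>a\<close> is the new
        null vector.\<close>
      define k where "k = (LEAST k. (mul b ^^ k) a = 0)"
      have k: "(mul b ^^ k) a = 0" unfolding k_def using nil[OF b a(1)] by (rule LeastI_ex)
      have "k \<noteq> 0" using k a(2) by (auto intro: ccontr)
      then obtain j where j: "k = Suc j" by (cases k) auto
      have "(mul b ^^ j) a \<noteq> 0" using not_less_Least[of j "\<lambda>k. (mul b ^^ k) a = 0"] j unfolding k_def by auto
      moreover have "mul b ((mul b ^^ j) a) = 0" using k j by simp
      moreover have "(mul b ^^ i) a \<in> A \<and> (\<forall>s\<in>F. mul s ((mul b ^^ i) a) = 0)" for i
      proof (induction i)
        case (Suc i)
        have "mul s (mul b ((mul b ^^ i) a)) = 0" if "s \<in> F" for s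
        proof -
          \<comment> \<open>Thus \<open>s\<close> and \<open>b\<close> commute on \<open>A\<close>,
            and iterates of \<open>b\<close> stay killed by \<open>F\<close>.\<close>
          have "mul s b \<in> C" using that insert.prems b BB by auto
          then have "mul (mul s b) ((mul b ^^ i) a) = 0" using Suc C_iff by blast
          then show ?thesis using Suc that by (simp add: leibniz[of s b])
        qed
        then show ?case using Suc by (auto intro: ideal_mul_right ideal_A)
      qed (use a in auto)
      ultimately show ?case by blast
    qed
    then obtain a where a: "a \<in> A" "a \<noteq> 0" "\<forall>s\<in>S. mul s a = 0" by blast
    \<comment> \<open>This nonzero ideal must be \<open>A\<close>, which puts \<open>B\<close>
      inside \<open>C\<close> against the choice of \<open>n\<close>.\<close>
    let ?J = "{a \<in> A. \<forall>b\<in>B. mul b a = 0}"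
    have "mul b a = 0" if "b \<in> span S" for b
      using that by (induction rule: span_induct_alt) (auto simp: mul_add_left mul_scale_left a)
    then have "a \<in> ?J" using a S(3) by auto
    moreover have "leib_ideal ?J"
    proof (rule ideal_subset_AI)
      show "subspace ?J"
        using ideal_subspace[OF ideal_A]
        by (auto simp: subspace_def mul_add_right mul_scale_right)
    next
      fix x a assume a: "a \<in> ?J"
      have "mul b (mul x a) = 0" if "b \<in> B" for b
        using that a ideal_mul_left[OF B that] by (simp add: leibniz[of b x a])
      then show "mul x a \<in> ?J" using a ideal_mul_right[OF ideal_A] by simp
    qed auto
    ultimately have "?J = A" using minimal_cases[of ?J] a(2) by blast
    then have "B \<subseteq> C" unfolding C_iff subset_iff by blast
    then show False using n(1) by (simp add: B_def)
  qed
  then show ?thesis using that bbC unfolding regular_def by blast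
qed

section \<open>Passing between complements and ideals inside the centralizer\<close>

lemma inter_C_complement:
  assumes M: "M \<in> leib_complements A UNIV"
  shows "M \<inter> C \<in> leib_complements A C" and "leib_ideal (M \<inter> C)"
proof -
  have sub: "subspace M" "\<And>x y. x \<in> M \<Longrightarrow> y \<in> M \<Longrightarrow> mul x y \<in> M"
    and dec: "\<And>x. \<exists>a m. x = a + m \<and> a \<in> A \<and> m \<in> M" and int: "A \<inter> M = {0}"
    using M unfolding leib_complements_def leib_subalgebra_def by blast+
  have subC: "subspace (M \<inter> C)" using sub(1) ideal_subspace[OF ideal_C] by (rule subspace_inter)
  have "mul x y \<in> M \<inter> C \<and> mul y x \<in> M \<inter> C" if y: "y \<in> M \<inter> C" for x y
  proof -
    obtain a m where x: "x = a + m" "a \<in> A" "m \<in> M" using dec by blast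
    \<comment> \<open>The \<open>A\<close>-part of \<open>x\<close> contributes nothing, so closure
      of \<open>M\<close> under products suffices.\<close>
    have "mul a y = 0" "mul y a = 0" using y x(2) by (auto simp: leib_centralizer_def)
    then have "mul x y = mul m y" "mul y x = mul y m" by (auto simp: x(1) mul_add_left mul_add_right)
    then show ?thesis
      using sub(2) x(3) y ideal_C by (auto intro: ideal_mul_left ideal_mul_right)
  qed
  then show "leib_ideal (M \<inter> C)" using subC by (simp add: leib_ideal_def)
  have "C \<subseteq> {a + m |a m. a \<in> A \<and> m \<in> M \<inter> C}"
  proof
    fix x assume x: "x \<in> C"
    obtain a m where am: "x = a + m" "a \<in> A" "m \<in> M" using dec by blast
    have "x - a \<in> C" using x am(2) A_subset_C by (intro ideal_diff[OF ideal_C]) auto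
    then have "m \<in> C" by (simp add: am(1))
    then show "x \<in> {a + m |a m. a \<in> A \<and> m \<in> M \<inter> C}" using am by blast
  qed
  moreover have "{a + m |a m. a \<in> A \<and> m \<in> M \<inter> C} \<subseteq> C"
    using A_subset_C ideal_add[OF ideal_C] by auto
  moreover have "A \<inter> (M \<inter> C) = {0}" using int A_subset_C by auto
  moreover have "leib_subalgebra (M \<inter> C)"
    using subC sub(2) ideal_mul_left[OF ideal_C] by (auto simp: leib_subalgebra_def)
  ultimately show "M \<inter> C \<in> leib_complements A C"
    unfolding leib_complements_def by blast
qed

lemma regular_complement:
  assumes b: "regular b" and D: "D \<in> leib_complements A C" and ideal_D: "leib_ideal D"
  defines "M \<equiv> {x. mul b (mul b x) \<in> D}"
  shows "M \<in> leib_complements A UNIV" and "M \<inter> C = D"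
proof -
  have DC: "D \<subseteq> C" and decC: "\<And>x. x \<in> C \<Longrightarrow> \<exists>a d. x = a + d \<and> a \<in> A \<and> d \<in> D" and int: "A \<inter> D = {0}"
    using D unfolding leib_complements_def by blast+
  have bbC: "mul b (mul b x) \<in> C" for x using b by (simp add: regular_def)
  have bbA: "a = 0" if "a \<in> A" "mul b (mul b a) \<in> D" for a
  proof -
    have "mul b (mul b a) \<in> A" using that(1) ideal_mul_right[OF ideal_A] by blast
    then have "mul b (mul b a) = 0" using that(2) int by blast
    then show ?thesis using that(1) b ideal_mul_right[OF ideal_A] unfolding regular_def by blast
  qed
  have subM: "subspace M" unfolding M_def by (rule subspace_left_mul_vimage[OF ideal_subspace[OF ideal_D]])
  have DM: "D \<subseteq> M" using ideal_mul_right[OF ideal_D] by (auto simp: M_def)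
  have AM: "A \<inter> M = {0}"
    using bbA ideal_zero[OF ideal_A] subspace_0[OF subM] by (auto simp: M_def)
  have dec: "x \<in> {a + m |a m. a \<in> A \<and> m \<in> M}" for x
  proof -
    obtain a d where ad: "mul b (mul b x) = a + d" "a \<in> A" "d \<in> D" using decC[OF bbC] by blast
    \<comment> \<open>Inverting \<open>b\<close> twice on \<open>A\<close> yields the correction
      \<open>c\<close> that removes the \<open>A\<close>-part.\<close>
    obtain a' where a': "a' \<in> A" "mul b a' = a" using regular_surj[OF b ad(2)] .
    obtain c where c: "c \<in> A" "mul b c = a'" using regular_surj[OF b a'(1)] .
    have "x - c \<in> M" by (simp add: M_def mul_diff_right ad c a')
    moreover have "x = c + (x - c)" by simp
    ultimately show ?thesis using c(1) by blast
  qed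
  have mulM: "mul x y \<in> M" if "x \<in> M" "y \<in> M" for x y
  proof -
    note [intro] = ideal_add[OF ideal_D] ideal_mul_left[OF ideal_D] ideal_mul_right[OF ideal_D]
    have xy: "mul b (mul b x) \<in> D" "mul b (mul b y) \<in> D" using that by (auto simp: M_def)
    \<comment> \<open>The mixed term of the second-order rule is not controlled directly; two more
      applications of \<open>b\<close> bring every summand into \<open>D\<close>.\<close>
    let ?t = "mul (mul b x) (mul b y)"
    have "mul b (mul b ?t) \<in> D"
      unfolding left_mul_twice_mul[of b "mul b x"] using xy by blast
    then have "mul b (mul b (mul b (mul b (mul x y)))) \<in> D"
      unfolding left_mul_twice_mul[of b x] mul_add_right using xy by blast
    \<comment> \<open>The two extra applications are undone by splitting along \<open>A\<close> and
      \<open>D\<close>: \<open>bbA\<close> kills the \<open>A\<close>-part.\<close>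
    moreover obtain a d where ad: "mul b (mul b (mul x y)) = a + d" "a \<in> A" "d \<in> D"
      using decC[OF bbC] by blast
    ultimately have "mul b (mul b a) + mul b (mul b d) \<in> D" by (simp add: mul_add_right)
    then have "mul b (mul b a) + mul b (mul b d) - mul b (mul b d) \<in> D"
      using ad(3) by (intro ideal_diff[OF ideal_D]) auto
    then have "a = 0" using bbA[OF ad(2)] by simp
    then show ?thesis using ad by (simp add: M_def)
  qed
  show "M \<in> leib_complements A UNIV"
    using subM mulM AM dec unfolding leib_complements_def leib_subalgebra_def by blast
  show "M \<inter> C = D"
  proof
    show "M \<inter> C \<subseteq> D"
    proof
      fix x assume x: "x \<in> M \<inter> C"
      then obtain a d where ad: "x = a + d" "a \<in> A" "d \<in> D" using decC by blast
      have "x - d \<in> M" using x ad(3) DM by (intro subspace_diff[OF subM]) auto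
      then have "a \<in> M" by (simp add: ad(1))
      then have "a = 0" using AM ad(2) by blast
      then show "x \<in> D" using ad by simp
    qed
  qed (use DM DC in auto)
qed

text \<open>The right-hand side is a complement containing \<open>U\<close>, and nested complements
  agree. So \<open>U\<close> is determined by \<open>u\<close> and
  \<open>U \<inter> C\<close>.\<close>

lemma complement_eq_regular:
  assumes U: "U \<in> leib_complements A UNIV" and u: "u \<in> U" "regular u"
  shows "U = {x. mul u (mul u x) \<in> U \<inter> C}"
proof (rule complements_subset_eq[OF U])
  show "{x. mul u (mul u x) \<in> U \<inter> C} \<in> leib_complements A UNIV"
    using regular_complement u inter_C_complement U by blast
  show "U \<subseteq> {x. mul u (mul u x) \<in> U \<inter> C}"
    using U u by (auto simp: leib_complements_def leib_subalgebra_def regular_def)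
qed

section \<open>Conjugacy under the inner group and the final bijection\<close>

lemma exp_left_mul_A: "a \<in> A \<Longrightarrow> exp_left_mul a x = x + mul a x"
  using exp_left_mul_eq[OF ideal_A] mul_A_A by blast

text \<open>Left multiplication by \<open>a\<close> squares to zero, so changing its sign gives the
  inverse; the quadratic term in the product vanishes because \<open>A\<close> is abelian.\<close>

lemma exp_left_mul_automorphism:
  assumes a: "a \<in> A"
  shows "leib_automorphism (exp_left_mul a)"
proof -
  have e: "exp_left_mul a = (\<lambda>x. x + mul a x)"
    using exp_left_mul_A[OF a] by blast
  have aa: "mul a (mul a x) = 0" for x
    using a mul_A_A ideal_mul_left[OF ideal_A] by blast
  have "Vector_Spaces.linear scale scale (\<lambda>x. x + mul a x)"
    by unfold_locales (simp_all add: mul_add_right mul_scale_right scale_right_distrib algebra_simps)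
  moreover have "bij (\<lambda>x. x + mul a x)"
    by (rule o_bij[where g = "\<lambda>x. x - mul a x"])
      (auto simp: fun_eq_iff mul_add_right mul_diff_right aa)
  moreover have "mul x y + mul a (mul x y) = mul (x + mul a x) (y + mul a y)" for x y
    using mul_A_A[of "mul a x" "mul a y"] a ideal_mul_left[OF ideal_A]
    by (simp add: mul_add_left mul_add_right leibniz[of a x y])
  ultimately show ?thesis by (simp add: leib_automorphism_def e)
qed

text \<open>Generators add \<open>mul a x\<close>, which is zero on \<open>C\<close>. Injectivity is
  carried along to pull membership back through \<open>\<beta>\<close>.\<close>

lemma inner_group_fixes_C:
  assumes "\<beta> \<in> leib_inner_group A"
  shows "inj \<beta> \<and> (\<forall>x\<in>C. \<beta> x = x)"
  using assms unfolding leib_inner_group_def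
proof (induction rule: generate.induct)
  case one
  then show ?case by (simp add: leib_aut_group_def)
next
  case (incl h)
  then obtain a where a: "a \<in> A" "h = exp_left_mul a" by auto
  then have "inj h"
    using exp_left_mul_automorphism by (simp add: leib_automorphism_def bij_is_inj)
  moreover have "h x = x" if "x \<in> C" for x
    using a that by (simp add: exp_left_mul_A leib_centralizer_def)
  ultimately show ?case by blast
next
  case (inv h)
  then have h: "h \<in> carrier leib_aut_group" "\<forall>x\<in>C. h x = x"
    using exp_left_mul_automorphism
    by (auto simp: leib_aut_group_def exp_left_mul_A leib_centralizer_def)
  let ?g = "inv\<^bsub>leib_aut_group\<^esub> h"
  have "?g \<in> carrier leib_aut_group" "?g \<otimes>\<^bsub>leib_aut_group\<^esub> h = \<one>\<^bsub>leib_aut_group\<^esub>"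
    using group.inv_closed[OF group_leib_aut_group h(1)] group.l_inv[OF group_leib_aut_group h(1)]
    by auto
  then have "inj ?g" "\<And>x. ?g (h x) = x"
    by (auto simp: leib_aut_group_def leib_automorphism_def bij_is_inj fun_eq_iff)
  then show ?case using h(2) by metis
next
  case (eng g h)
  then have "inj (g \<circ> h)" "\<forall>x\<in>C. (g \<circ> h) x = x"
    by (auto intro: inj_compose)
  then show ?case by (simp add: leib_aut_group_def comp_def)
qed

lemma conjugate_iff:
  assumes U: "U \<in> leib_complements A UNIV" and V: "V \<in> leib_complements A UNIV"
  shows "conjugate_under (leib_inner_group A) U V \<longleftrightarrow> U \<inter> C = V \<inter> C"
proof
  assume "conjugate_under (leib_inner_group A) U V"
  then obtain \<beta> where \<beta>: "\<beta> \<in> leib_inner_group A" "\<beta> ` U = V"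
    by (auto simp: conjugate_under_def)
  note fixC = inner_group_fixes_C[OF \<beta>(1)]
  have "x \<in> U \<longleftrightarrow> x \<in> V" if "x \<in> C" for x
    using fixC that \<beta>(2) by (metis inj_image_mem_iff)
  then show "U \<inter> C = V \<inter> C" by blast
next
  assume eq: "U \<inter> C = V \<inter> C"
  have id: "id \<in> leib_inner_group A"
    using generate.one[of leib_aut_group] by (simp add: leib_inner_group_def leib_aut_group_def)
  have refl: "conjugate_under (leib_inner_group A) U V" if "U = V"
    using that id by (auto simp: conjugate_under_def intro: bexI[of _ id])
  show "conjugate_under (leib_inner_group A) U V"
  proof (cases "C = UNIV")
    case True
    then show ?thesis using eq refl by simp
  next
    case False
    obtain b where b: "regular b" using exists_regular[OF False] .
    \<comment> \<open>Every complement meets the coset of \<open>b\<close> modulo \<open>A\<close>,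
      in a regular element.\<close>
    have rep: "\<exists>a\<in>A. b - a \<in> M \<and> regular (b - a)" if "M \<in> leib_complements A UNIV" for M
    proof -
      have "b \<in> {a + m |a m. a \<in> A \<and> m \<in> M}" using that unfolding leib_complements_def by blast
      then obtain a m where am: "b = a + m" "a \<in> A" "m \<in> M" by blast
      then have "b - a \<in> M" by simp
      moreover have "regular (b + - a)" using b am ideal_uminus[OF ideal_A] by (intro regular_add_A)
      ultimately show ?thesis using am(2) by auto
    qed
    obtain p where p: "p \<in> A" "b - p \<in> U" "regular (b - p)" using rep[OF U] by blast
    obtain q where q: "q \<in> A" "b - q \<in> V" "regular (b - q)" using rep[OF V] by blast
    define u v where "u = b - p" and "v = b - q"
    have Ueq: "U = {x. mul u (mul u x) \<in> U \<inter> C}"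
      unfolding u_def by (rule complement_eq_regular[OF U p(2,3)])
    have Veq: "V = {x. mul v (mul v x) \<in> U \<inter> C}"
      unfolding v_def eq by (rule complement_eq_regular[OF V q(2,3)])
    have v: "v = u + (p - q)" by (simp add: u_def v_def)
    have pq: "p - q \<in> A" using p q ideal_diff[OF ideal_A] by blast
    show ?thesis
      using right_action_cases
    proof
      assume "\<forall>a\<in>A. \<forall>x. mul a x = 0"
      then have "mul v x = mul u x" for x using pq by (simp add: v mul_add_left)
      then have "U = V" by (subst Ueq, subst Veq) simp
      then show ?thesis by (rule refl)
    next
      assume anti: "\<forall>a\<in>A. \<forall>x. mul a x = - mul x a"
      \<comment> \<open>Chosen so that
        \<open>u + mul a u = u - mul u a = u + (p - q) = v\<close>.\<close>
      obtain a where a: "a \<in> A" "mul u a = - (p - q)"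
        using regular_surj[OF p(3) ideal_uminus[OF ideal_A pq]] unfolding u_def .
      let ?\<beta> = "exp_left_mul a"
      have \<beta>: "?\<beta> \<in> leib_inner_group A"
        unfolding leib_inner_group_def using a(1) by (auto intro: generate.incl)
      have aut: "bij ?\<beta>" "\<And>x y. ?\<beta> (mul x y) = mul (?\<beta> x) (?\<beta> y)"
        using exp_left_mul_automorphism[OF a(1)] by (auto simp: leib_automorphism_def)
      note fixC = inner_group_fixes_C[OF \<beta>]
      have \<beta>u: "?\<beta> u = v" using anti a by (simp add: exp_left_mul_A v)
      \<comment> \<open>If \<open>?\<beta> x\<close> lies in \<open>C\<close>, it is fixed by
        \<open>?\<beta>\<close>, so \<open>x = ?\<beta> x\<close> by injectivity.\<close>
      have D: "?\<beta> x \<in> U \<inter> C \<longleftrightarrow> x \<in> U \<inter> C" for x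
        using fixC by (metis IntD2 injD)
      have iff: "?\<beta> x \<in> V \<longleftrightarrow> x \<in> U" for x
      proof -
        have "?\<beta> x \<in> V \<longleftrightarrow> mul v (mul v (?\<beta> x)) \<in> U \<inter> C" by (subst Veq) simp
        also have "mul v (mul v (?\<beta> x)) = ?\<beta> (mul u (mul u x))" by (simp only: aut(2) \<beta>u)
        also have "\<dots> \<in> U \<inter> C \<longleftrightarrow> x \<in> U" unfolding D using Ueq by blast
        finally show ?thesis .
      qed
      have "U = ?\<beta> -` V" using iff by blast
      then have "?\<beta> ` U = V" using surj_image_vimage_eq[OF bij_is_surj[OF aut(1)]] by simp
      then show ?thesis using \<beta> by (auto simp: conjugate_under_def)
    qed
  qed
qed

lemma inter_C_image:
  "(\<lambda>M. M \<inter> C) ` leib_complements A UNIV = {D \<in> leib_complements A C. leib_ideal D}"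
proof (intro equalityI subsetI)
  fix D assume "D \<in> {D \<in> leib_complements A C. leib_ideal D}"
  then have D: "D \<in> leib_complements A C" "leib_ideal D" by auto
  show "D \<in> (\<lambda>M. M \<inter> C) ` leib_complements A UNIV"
  proof (cases "C = UNIV")
    case True
    \<comment> \<open>Here \<open>D\<close> is itself a complement in the whole algebra and is its
      own preimage.\<close>
    then show ?thesis using D(1) by (auto intro: image_eqI[of _ _ D])
  next
    case False
    then obtain b where "regular b" using exists_regular by blast
    then show ?thesis using regular_complement[OF _ D] by (auto simp: image_iff)
  qed
qed (auto simp: inter_C_complement)

lemma bij_betw_complement_classes:
  "bij_betw (\<lambda>K. the_elem ((\<lambda>M. M \<inter> C) ` K)) (complement_classes A)
     {D \<in> leib_complements A C. leib_ideal D}"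
proof -
  have "{(U, V). U \<in> leib_complements A UNIV \<and> V \<in> leib_complements A UNIV \<and>
           conjugate_under (leib_inner_group A) U V} =
        {(U, V). U \<in> leib_complements A UNIV \<and> V \<in> leib_complements A UNIV \<and> U \<inter> C = V \<inter> C}"
    using conjugate_iff by blast
  then show ?thesis
    unfolding complement_classes_def
    using bij_betw_quotient_kernel[OF inter_C_image] by simp
qed

end

theorem theorem2:
  fixes scale :: "'k::field \<Rightarrow> 'v::ab_group_add \<Rightarrow> 'v"
    and mul :: "'v \<Rightarrow> 'v \<Rightarrow> 'v"
    and A :: "'v set"
  assumes "leibniz_algebra scale mul"
    and "leibniz_algebra.solvable_leib scale mul"
    and "leibniz_algebra.minimal_leib_ideal scale mul A"
  shows "\<exists>f. bij_betw f
      (leibniz_algebra.complement_classes scale mul A)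
      {D \<in> leibniz_algebra.leib_complements scale mul A
              (leibniz_algebra.leib_centralizer mul A).
         leibniz_algebra.leib_ideal scale mul D}"
proof -
  interpret solvable_leibniz_minimal_ideal scale mul A
    using assms
    by (intro solvable_leibniz_minimal_ideal.intro solvable_leibniz_minimal_ideal_axioms.intro)
  show ?thesis using bij_betw_complement_classes by blast
qed

end
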